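(* Consider the sparse functional program (P-SFP) $$\begin{aligned}\underset{X\in\mathcal X,\ z\in\mathbb C^p}{\text{minimize}}\quad &\int_\Omega F_0[X(\beta),\beta]\,d\beta+\lambda\|X\|_{L_0}\\ \text{subject to}\quad & g_i(z)\le 0,\quad i=1,\dots,m,\\ & z=\int_\Omega F[X(\beta),\beta]\,d\beta,\\ & X(\beta)\in\mathcal P\ \text{ for a.e. }\beta\in\Omega,\end{aligned}$$ and its Lagrangian dual problem (D-SFP): maximize $d(\mu,\nu)$ over $\mu\in\mathbb C^p$ and $\nu\in\mathbb R^m$ with $\nu_i\ge 0$ for all $i$, where $d$ is the dual function defined in the context. Suppose that $F_0$ and $F$ have no point masses (Dirac deltas) and that there exists a feasible pair $(X',z')$ for (P-SFP), i.e., $X'\in\mathcal X$ with $X'(\beta)\in\mathcal P$ a.e. and $z'\in\mathbb C^p$ with $z'=\int_\Omega F[X'(\beta),\beta]\,d\beta$, such that $g_i(z')<0$ for all $i=1,\dots,m$. Let $P^\star$ be the optimal value of (P-SFP) and $D^\star$ the optimal value of (D-SFP). Then $P^\star=D^\star$.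
   Context: $\Omega\subset\mathbb R^n$ is compact, $\mathcal B$ is its Borel $\sigma$-algebra, and all integrals are with respect to Lebesgue measure $\mathfrak m$. For measurable $X:\Omega\to\mathbb C$, $\|X\|_{L_0}=\mathfrak m(\{\beta\in\Omega: X(\beta)\ne 0\})=\int_\Omega \mathbb I[X(\beta)\neq 0]\,d\beta$. Data: $\lambda>0$; $g_i:\mathbb C^p\to\mathbb R$ are convex functions ($i=1,\dots,m$); $F_0:\mathbb C\times\Omega\to\mathbb R$ and $F:\mathbb C\times\Omega\to\mathbb C^p$ are possibly nonlinear, not necessarily convex functions; $\mathcal P\subseteq\mathbb C$ is a possibly non-convex set; $\mathcal X$ is a decomposable space of measurable functions $\Omega\to\mathbb C$, meaning that if $X,X'\in\mathcal X$ and $\mathcal Z\in\mathcal B$, then the function equal to $X$ on $\mathcal Z$ and to $X'$ on $\Omega\setminus\mathcal Z$ belongs to $\mathcal X$. Convention: the integrals of $F_0[X(\beta),\beta]$ and $F[X(\beta),\beta]$ are well defined and finite for the functions $X$ under consideration (the optimization ranges over such $X$). "No point masses (Dirac deltas)" means that, for each such $X$, the set functions $\mathcal Z\mapsto\int_{\mathcal Z}F_0[X(\beta),\beta]\,d\beta$ and $\mathcal Z\mapsto\int_{\mathcal Z}F[X(\beta),\beta]\,d\beta$ are non-atomic (vector) measures on $(\Omega,\mathcal B)$. The Lagrangian is $$\mathcal L(X,z,\mu,\nu)=\int_\Omega F_0[X(\beta),\beta]d\beta+\lambda\|X\|_{L_0}+\mathrm{Re}\Big[\mu^H\Big(\int_\Omega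 F[X(\beta),\beta]d\beta-z\Big)\Big]+\sum_{i=1}^m\nu_i g_i(z),$$ for $\mu\in\mathbb C^p$, $\nu\in\mathbb R_+^m$, where $\mu^H$ is the conjugate transpose. The dual function $d(\mu,\nu)$ is the minimum (infimum, possibly $-\infty$) of $\mathcal L(X,z,\mu,\nu)$ over $X\in\mathcal X$ with $X(\beta)\in\mathcal P$ a.e. and $z\in\mathbb C^p$. Optimal values are understood as an infimum (primal) and a supremum (dual). *)

theory Defs
  imports "HOL-Analysis.Analysis"
begin

(* Functions on Omega are total functions on real^'n whose values outside Omega are never used.
   Hence the spliced function is required to be in the space only up to its values outside Omega. *)
definition decomposable :: "(real^'n) set \<Rightarrow> (real^'n \<Rightarrow> complex) set \<Rightarrow> bool" where
  "decomposable \<Omega> \<X> \<longleftrightarrow>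
     (\<forall>X\<in>\<X>. \<forall>X'\<in>\<X>. \<forall>Z\<in>sets (restrict_space borel \<Omega>).
        \<exists>Y\<in>\<X>. (\<forall>\<beta>\<in>Z. Y \<beta> = X \<beta>) \<and> (\<forall>\<beta>\<in>\<Omega> - Z. Y \<beta> = X' \<beta>))"

(* For signed and vector measures: no A is an atom, i.e. has w A \<noteq> 0 and w B = 0 or w (A - B) = 0
   for every measurable B \<subseteq> A. *)
definition nonatomic :: "'a measure \<Rightarrow> ('a set \<Rightarrow> 'b::real_normed_vector) \<Rightarrow> bool" where
  "nonatomic M w \<longleftrightarrow>
     (\<forall>A\<in>sets M. w A \<noteq> 0 \<longrightarrow> (\<exists>B\<in>sets M. B \<subseteq> A \<and> w B \<noteq> 0 \<and> w (A - B) \<noteq> 0))"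

definition L0_norm :: "(real^'n) set \<Rightarrow> (real^'n \<Rightarrow> complex) \<Rightarrow> real" where
  "L0_norm \<Omega> X = measure lebesgue {\<beta>\<in>\<Omega>. X \<beta> \<noteq> 0}"

(* mu^H v *)
definition herm_prod :: "complex^'p \<Rightarrow> complex^'p \<Rightarrow> complex" where
  "herm_prod \<mu> v = (\<Sum>j\<in>UNIV. cnj (\<mu> $ j) * v $ j)"

(* The functions the optimization ranges over, for the primal and for the dual function:
   in particular both integrals must be well defined and finite. *)
definition admissible ::
  "(real^'n) set \<Rightarrow> (real^'n \<Rightarrow> complex) set \<Rightarrow> complex set \<Rightarrow>
   (complex \<Rightarrow> real^'n \<Rightarrow> real) \<Rightarrow> (complex \<Rightarrow> real^'n \<Rightarrow> complex^'p) \<Rightarrow> (real^'n \<Rightarrow> complex) set" where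
  "admissible \<Omega> \<X> \<P> F0 F =
     {X\<in>\<X>. (AE \<beta> in lebesgue_on \<Omega>. X \<beta> \<in> \<P>) \<and>
             integrable (lebesgue_on \<Omega>) (\<lambda>\<beta>. F0 (X \<beta>) \<beta>) \<and>
             integrable (lebesgue_on \<Omega>) (\<lambda>\<beta>. F (X \<beta>) \<beta>)}"

definition sfp_objective ::
  "(real^'n) set \<Rightarrow> real \<Rightarrow> (complex \<Rightarrow> real^'n \<Rightarrow> real) \<Rightarrow> (real^'n \<Rightarrow> complex) \<Rightarrow> real" where
  "sfp_objective \<Omega> lam F0 X = (\<integral>\<beta>. F0 (X \<beta>) \<beta> \<partial>lebesgue_on \<Omega>) + lam * L0_norm \<Omega> X"

definition sfp_feasible ::
  "(real^'n) set \<Rightarrow> (real^'n \<Rightarrow> complex) set \<Rightarrow> complex set \<Rightarrow>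
   (complex \<Rightarrow> real^'n \<Rightarrow> real) \<Rightarrow> (complex \<Rightarrow> real^'n \<Rightarrow> complex^'p) \<Rightarrow>
   ('m \<Rightarrow> complex^'p \<Rightarrow> real) \<Rightarrow> ((real^'n \<Rightarrow> complex) \<times> (complex^'p)) set" where
  "sfp_feasible \<Omega> \<X> \<P> F0 F g =
     {(X, z). X \<in> admissible \<Omega> \<X> \<P> F0 F \<and>
              (\<forall>i. g i z \<le> 0) \<and>
              z = (\<integral>\<beta>. F (X \<beta>) \<beta> \<partial>lebesgue_on \<Omega>)}"

definition sfp_primal_value ::
  "(real^'n) set \<Rightarrow> (real^'n \<Rightarrow> complex) set \<Rightarrow> complex set \<Rightarrow> real \<Rightarrow>
   (complex \<Rightarrow> real^'n \<Rightarrow> real) \<Rightarrow> (complex \<Rightarrow> real^'n \<Rightarrow> complex^'p) \<Rightarrow>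
   ('m \<Rightarrow> complex^'p \<Rightarrow> real) \<Rightarrow> ereal" where
  "sfp_primal_value \<Omega> \<X> \<P> lam F0 F g =
     (INF (X, z)\<in>sfp_feasible \<Omega> \<X> \<P> F0 F g. ereal (sfp_objective \<Omega> lam F0 X))"

definition sfp_lagrangian ::
  "(real^'n) set \<Rightarrow> real \<Rightarrow>
   (complex \<Rightarrow> real^'n \<Rightarrow> real) \<Rightarrow> (complex \<Rightarrow> real^'n \<Rightarrow> complex^'p) \<Rightarrow>
   ('m::finite \<Rightarrow> complex^'p \<Rightarrow> real) \<Rightarrow>
   (real^'n \<Rightarrow> complex) \<Rightarrow> complex^'p \<Rightarrow> complex^'p \<Rightarrow> real^'m \<Rightarrow> real" where
  "sfp_lagrangian \<Omega> lam F0 F g X z \<mu> \<nu> =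
     (\<integral>\<beta>. F0 (X \<beta>) \<beta> \<partial>lebesgue_on \<Omega>) + lam * L0_norm \<Omega> X
     + Re (herm_prod \<mu> ((\<integral>\<beta>. F (X \<beta>) \<beta> \<partial>lebesgue_on \<Omega>) - z))
     + (\<Sum>i\<in>UNIV. \<nu> $ i * g i z)"

definition sfp_dual_function ::
  "(real^'n) set \<Rightarrow> (real^'n \<Rightarrow> complex) set \<Rightarrow> complex set \<Rightarrow> real \<Rightarrow>
   (complex \<Rightarrow> real^'n \<Rightarrow> real) \<Rightarrow> (complex \<Rightarrow> real^'n \<Rightarrow> complex^'p) \<Rightarrow>
   ('m::finite \<Rightarrow> complex^'p \<Rightarrow> real) \<Rightarrow> complex^'p \<Rightarrow> real^'m \<Rightarrow> ereal" where
  "sfp_dual_function \<Omega> \<X> \<P> lam F0 F g \<mu> \<nu> =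
     (INF (X, z)\<in>admissible \<Omega> \<X> \<P> F0 F \<times> UNIV. ereal (sfp_lagrangian \<Omega> lam F0 F g X z \<mu> \<nu>))"

definition sfp_dual_value ::
  "(real^'n) set \<Rightarrow> (real^'n \<Rightarrow> complex) set \<Rightarrow> complex set \<Rightarrow> real \<Rightarrow>
   (complex \<Rightarrow> real^'n \<Rightarrow> real) \<Rightarrow> (complex \<Rightarrow> real^'n \<Rightarrow> complex^'p) \<Rightarrow>
   ('m::finite \<Rightarrow> complex^'p \<Rightarrow> real) \<Rightarrow> ereal" where
  "sfp_dual_value \<Omega> \<X> \<P> lam F0 F g =
     (SUP (\<mu>, \<nu>)\<in>{(\<mu>, \<nu>). \<forall>i. 0 \<le> \<nu> $ i}. sfp_dual_function \<Omega> \<X> \<P> lam F0 F g \<mu> \<nu>)"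

end

theory Submission
  imports Defs
begin

text \<open>
  Strong duality needs only an approximate form of Lyapunov's convexity theorem. Let \<open>A\<close> be the set
  of pairs (objective of \<open>X\<close>, integral of \<open>F[X]\<close>) over the admissible \<open>X\<close>. Level sets of an integrable
  simple function can be cut by half-spaces into pieces of any prescribed proportion, so every
  integrable density has, up to any error, a Borel set carrying a prescribed proportion of its
  integral. Splicing two admissible functions along such a set shows that the closure of \<open>A\<close> is
  convex. The constraints \<open>g i < 0\<close> define an open set, so the primal value also bounds the objective
  on the part of the closure that satisfies them, and a separating hyperplane, normalised with the
  help of the Slater point, yields optimal multipliers.
\<close>

section \<open>Approximate Lyapunov convexity for Lebesgue densities\<close>

text \<open>Sweep \<open>A\<close> by the half-spaces \<open>H t\<close> orthogonal to a coordinate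
  axis. The measure of \<open>A \<inter> H t\<close> is continuous in \<open>t\<close> because
  hyperplanes are negligible, and it grows from 0 to the measure of \<open>A\<close> since
  \<open>A\<close> is bounded, so every intermediate value is attained.\<close>

lemma ex_lebesgue_subset_measure_eq:
  fixes A :: "'a::euclidean_space set"
  assumes A: "A \<in> sets lebesgue" "bounded A" and \<theta>: "0 \<le> \<theta>" "\<theta> \<le> 1"
  shows "\<exists>B\<in>sets lebesgue. B \<subseteq> A \<and> measure lebesgue B = \<theta> * measure lebesgue A"
proof -
  obtain b :: 'a where b: "b \<in> Basis"
    using nonempty_Basis by blast
  define H where "H t = {x::'a. x \<bullet> b \<le> t}" for t
  define \<phi> where "\<phi> t = measure lebesgue (A \<inter> H t)" for t
  have H: "H t \<in> sets lebesgue" for t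
    unfolding H_def using borel_closed[OF closed_halfspace_component_le[of b t]] by simp
  have AH: "A \<inter> H t \<in> lmeasurable" for t
    using A H by (intro bounded_set_imp_lmeasurable) (auto intro: bounded_subset)
  have \<phi>: "\<phi> t = integral\<^sup>L lebesgue (indicat_real (A \<inter> H t))" for t
    using AH[of t] by (simp add: \<phi>_def)
  have A': "A \<in> lmeasurable"
    using A by (intro bounded_set_imp_lmeasurable) auto
  have "\<phi> \<midarrow>t\<rightarrow> \<phi> t" for t
  proof -
    have "(\<lambda>n. \<phi> (u n)) \<longlonglongrightarrow> \<phi> t" if u: "u \<longlonglongrightarrow> t" for u
      unfolding \<phi>
    proof (rule integral_dominated_convergence)
      show "integrable lebesgue (indicat_real A)"
        using A' by (simp add: lmeasurable_iff_integrable)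
      have "negligible {x. x \<bullet> b = t}"
        using b by (rule negligible_standard_hyperplane)
      then have "AE x in lebesgue. x \<bullet> b \<noteq> t"
        by (auto simp: negligible_iff_null_sets intro: AE_I' )
      then show "AE x in lebesgue. (\<lambda>n. indicat_real (A \<inter> H (u n)) x) \<longlonglongrightarrow> indicat_real (A \<inter> H t) x"
      proof eventually_elim
        case (elim x)
        \<comment> \<open>Off the limiting hyperplane, membership of \<open>x\<close> in
          \<open>H (u n)\<close> is eventually constant, so the indicators converge at
          \<open>x\<close>.\<close>
        have "eventually (\<lambda>n. x \<bullet> b \<le> u n \<longleftrightarrow> x \<bullet> b \<le> t) sequentially"
        proof (cases "x \<bullet> b < t")
          case True
          show ?thesis
            using order_tendstoD(1)[OF u True] by eventually_elim (use True in auto)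
        next
          case False
          then have "t < x \<bullet> b"
            using elim by simp
          from order_tendstoD(2)[OF u this] show ?thesis
            by eventually_elim (use False elim in auto)
        qed
        then show ?case
          by (intro tendsto_eventually) (auto elim!: eventually_mono simp: H_def indicator_def)
      qed
    qed (use AH in \<open>auto simp: indicator_def intro!: borel_measurable_indicator fmeasurableD\<close>)
    then show ?thesis
      by (auto intro!: sequentially_imp_eventually_within simp: tendsto_at_iff_sequentially o_def)
  qed
  then have cont: "isCont \<phi> t" for t
    by (simp add: isCont_def)
  obtain r where r: "r > 0" "\<And>x. x \<in> A \<Longrightarrow> norm x < r"
    using \<open>bounded A\<close> bounded_pos_less by blast
  have *: "\<bar>x \<bullet> b\<bar> < r" if "x \<in> A" for x
    using r(2)[OF that] Basis_le_norm[OF b, of x] by simp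
  have "A \<inter> H (-r) = {}" "A \<inter> H r = A"
    using * by (force simp: H_def)+
  then have "\<phi> (-r) \<le> \<theta> * measure lebesgue A" "\<theta> * measure lebesgue A \<le> \<phi> r"
    using \<theta> by (auto simp: \<phi>_def mult_left_le_one_le)
  with IVT[of \<phi> "-r" "\<theta> * measure lebesgue A" r] cont r(1)
  obtain t where "\<phi> t = \<theta> * measure lebesgue A"
    by auto
  then show ?thesis
    using AH[of t] by (intro bexI[of _ "A \<inter> H t"]) (auto simp: \<phi>_def)
qed

text \<open>For a simple function, taking the proportion \<open>\<theta>\<close> of each level set
  scales the integral by exactly \<open>\<theta>\<close>. A general density is replaced by a simple
  function close to it in the L1 norm.\<close>

lemma (in finite_measure) approx_lyapunov:
  fixes f :: "'a \<Rightarrow> 'b::{banach, second_countable_topology}"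
  assumes div: "\<And>A. A \<in> sets M \<Longrightarrow> \<exists>B\<in>sets M. B \<subseteq> A \<and> measure M B = \<theta> * measure M A"
    and f: "integrable M f" and e: "e > 0" and \<theta>: "0 \<le> \<theta>" "\<theta> \<le> 1"
  shows "\<exists>Z\<in>sets M. norm ((\<integral>x. indicator Z x *\<^sub>R f x \<partial>M) - \<theta> *\<^sub>R integral\<^sup>L M f) < e"
proof -
  obtain s where s: "\<And>i. Bochner_Integration.simple_bochner_integrable M (s i)"
    and lim: "(\<lambda>i. \<integral>\<^sup>+x. norm (f x - s i x) \<partial>M) \<longlonglongrightarrow> 0"
    using f by (auto simp: integrable.simps has_bochner_integral.simps)
  \<comment> \<open>Half of \<open>e\<close>, because the L1 error enters twice: through the
    integral over \<open>Z\<close> and through the scaled integral over the whole space.\<close>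
  have "eventually (\<lambda>i. (\<integral>\<^sup>+x. norm (f x - s i x) \<partial>M) < ennreal (e/2)) sequentially"
    using e by (intro order_tendstoD(2)[OF lim]) auto
  then obtain i where i: "(\<integral>\<^sup>+x. norm (f x - s i x) \<partial>M) < ennreal (e/2)"
    by (auto simp: eventually_sequentially)
  define u where "u = s i"
  have u: "simple_function M u"
    using s[of i] by (simp add: u_def simple_bochner_integrable.simps)
  have ui: "integrable M u"
    using s[of i] by (auto simp: u_def integrable.simps dest: has_bochner_integral_simple_bochner_integrable)
  have fu: "integrable M (\<lambda>x. f x - u x)"
    using f ui by simp
  have small: "(\<integral>x. norm (f x - u x) \<partial>M) < e/2"
  proof -
    have "ennreal (\<integral>x. norm (f x - u x) \<partial>M) = (\<integral>\<^sup>+x. norm (f x - u x) \<partial>M)"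
      using fu by (intro nn_integral_eq_integral[symmetric]) auto
    also have "\<dots> < ennreal (e/2)"
      using i by (simp add: u_def)
    finally show ?thesis
      using e by (simp add: ennreal_less_iff)
  qed
  define A where "A c = u -` {c} \<inter> space M" for c
  have A: "A c \<in> sets M" for c
    unfolding A_def using u by (rule simple_functionD)
  have fin: "finite (u ` space M)"
    using u by (rule simple_functionD)
  from div[OF A] obtain B where B: "\<And>c. B c \<in> sets M" "\<And>c. B c \<subseteq> A c"
    "\<And>c. measure M (B c) = \<theta> * measure M (A c)"
    by metis
  define Z where "Z = (\<Union>c\<in>u ` space M. B c)"
  have Z: "Z \<in> sets M"
    unfolding Z_def using fin B(1) by (intro sets.finite_UN)
  have Zi: "integrable M (\<lambda>x. indicator Z x *\<^sub>R h x)" if "integrable M h" for h :: "'a \<Rightarrow> 'b"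
    using Z that by (rule integrable_mult_indicator)
  \<comment> \<open>The level sets are disjoint, so a point of \<open>Z\<close> can only come from
    the piece of its own level set.\<close>
  have ZB: "x \<in> Z \<longleftrightarrow> x \<in> B (u x)" if "x \<in> space M" for x
    using B(2) that by (fastforce simp: Z_def A_def)
  have sum: "(\<integral>x. (\<Sum>c\<in>u ` space M. indicator (C c) x *\<^sub>R c) \<partial>M) = (\<Sum>c\<in>u ` space M. measure M (C c) *\<^sub>R c)"
    if "\<And>c. C c \<in> sets M" for C
    using that by (subst Bochner_Integration.integral_sum) (auto simp: less_top[symmetric])
  have "(\<integral>x. indicator Z x *\<^sub>R u x \<partial>M) = (\<integral>x. (\<Sum>c\<in>u ` space M. indicator (B c) x *\<^sub>R c) \<partial>M)"
  proof (rule Bochner_Integration.integral_cong)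
    fix x assume x: "x \<in> space M"
    have "(\<Sum>c\<in>u ` space M. indicator (B c) x *\<^sub>R c) = (\<Sum>c\<in>{u x}. indicator (B c) x *\<^sub>R c)"
    proof (rule sum.mono_neutral_right)
      show "\<forall>c\<in>u ` space M - {u x}. indicator (B c) x *\<^sub>R c = 0"
        using B(2) by (fastforce simp: indicator_def A_def)
    qed (use x fin in auto)
    then show "indicator Z x *\<^sub>R u x = (\<Sum>c\<in>u ` space M. indicator (B c) x *\<^sub>R c)"
      using ZB[OF x] by (simp add: indicator_def)
  qed simp
  also have "\<dots> = \<theta> *\<^sub>R (\<Sum>c\<in>u ` space M. measure M (A c) *\<^sub>R c)"
    using B by (simp add: sum scaleR_sum_right)
  also have "(\<Sum>c\<in>u ` space M. measure M (A c) *\<^sub>R c) = (\<integral>x. (\<Sum>c\<in>u ` space M. indicator (A c) x *\<^sub>R c) \<partial>M)"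
    using A by (simp add: sum)
  also have "\<dots> = integral\<^sup>L M u"
  proof (rule Bochner_Integration.integral_cong)
    fix x assume x: "x \<in> space M"
    have "(\<Sum>c\<in>u ` space M. indicator (A c) x *\<^sub>R c) = (\<Sum>c\<in>{u x}. indicator (A c) x *\<^sub>R c)"
      using x fin by (intro sum.mono_neutral_right) (auto simp: indicator_def A_def)
    then show "(\<Sum>c\<in>u ` space M. indicator (A c) x *\<^sub>R c) = u x"
      using x by (simp add: A_def)
  qed simp
  finally have Zu: "(\<integral>x. indicator Z x *\<^sub>R u x \<partial>M) = \<theta> *\<^sub>R integral\<^sup>L M u" .
  \<comment> \<open>The contributions of \<open>u\<close> cancel by \<open>Zu\<close>; only those of
    \<open>f - u\<close> remain.\<close>
  have "(\<integral>x. indicator Z x *\<^sub>R f x \<partial>M) - \<theta> *\<^sub>R integral\<^sup>L M f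
      = (\<integral>x. indicator Z x *\<^sub>R (f x - u x) \<partial>M) - \<theta> *\<^sub>R (\<integral>x. f x - u x \<partial>M)"
    using f ui Zi[OF f] Zi[OF ui] Zu by (simp add: scaleR_diff_right)
  also have "norm \<dots> \<le> norm (\<integral>x. indicator Z x *\<^sub>R (f x - u x) \<partial>M) + \<bar>\<theta>\<bar> * norm (\<integral>x. f x - u x \<partial>M)"
    by (rule norm_triangle_le_diff) simp
  also have "\<dots> \<le> (\<integral>x. norm (f x - u x) \<partial>M) + 1 * (\<integral>x. norm (f x - u x) \<partial>M)"
  proof (intro add_mono mult_mono)
    show "norm (\<integral>x. indicator Z x *\<^sub>R (f x - u x) \<partial>M) \<le> (\<integral>x. norm (f x - u x) \<partial>M)"
      using fu by (intro integral_norm_bound[THEN order_trans] integral_mono integrable_norm Zi)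
        (auto simp: indicator_def)
  qed (use \<theta> in auto)
  finally show ?thesis
    using small Z by (intro bexI[of _ Z]) auto
qed

text \<open>Splicing is allowed only along relatively Borel sets. The Lebesgue set given by
  \<open>approx_lyapunov\<close> is therefore replaced by its Borel part \<open>S\<close>, from
  which it differs by a subset of a null set, so the integral is unchanged.\<close>

lemma ex_borel_approx_lyapunov:
  fixes \<Omega> :: "'a::euclidean_space set" and f :: "'a \<Rightarrow> 'b::{banach, second_countable_topology}"
  assumes \<Omega>: "compact \<Omega>" and f: "integrable (lebesgue_on \<Omega>) f"
    and e: "e > 0" and \<theta>: "0 \<le> \<theta>" "\<theta> \<le> 1"
  shows "\<exists>Z\<in>sets (restrict_space borel \<Omega>).
    norm ((\<integral>x. indicator Z x *\<^sub>R f x \<partial>lebesgue_on \<Omega>) - \<theta> *\<^sub>R integral\<^sup>L (lebesgue_on \<Omega>) f) < e"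
proof -
  have \<Omega>b: "\<Omega> \<in> sets borel"
    using \<Omega> by (simp add: borel_compact)
  have \<Omega>l: "\<Omega> \<in> lmeasurable" "\<Omega> \<in> sets lebesgue"
    using \<Omega> lmeasurable_compact fmeasurableD by blast+
  interpret finite_measure "lebesgue_on \<Omega>"
    using \<Omega>l by (intro finite_measure_lebesgue_on)
  have "\<exists>B\<in>sets (lebesgue_on \<Omega>). B \<subseteq> A \<and> measure (lebesgue_on \<Omega>) B = \<theta> * measure (lebesgue_on \<Omega>) A"
    if "A \<in> sets (lebesgue_on \<Omega>)" for A
  proof -
    have A: "A \<in> sets lebesgue" "A \<subseteq> \<Omega>"
      using that \<Omega>l by (auto simp: sets_restrict_space_iff)
    with \<Omega> have "bounded A"
      by (meson bounded_subset compact_imp_bounded)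
    then obtain B where B: "B \<in> sets lebesgue" "B \<subseteq> A" "measure lebesgue B = \<theta> * measure lebesgue A"
      using ex_lebesgue_subset_measure_eq[OF A(1) _ \<theta>] by metis
    with A \<Omega>l show ?thesis
      by (intro bexI[of _ B]) (auto simp: measure_restrict_space sets_restrict_space_iff)
  qed
  from approx_lyapunov[OF this f e \<theta>] obtain Z where Z: "Z \<in> sets (lebesgue_on \<Omega>)"
    "norm ((\<integral>x. indicator Z x *\<^sub>R f x \<partial>lebesgue_on \<Omega>) - \<theta> *\<^sub>R integral\<^sup>L (lebesgue_on \<Omega>) f) < e"
    by blast
  then have "Z \<subseteq> \<Omega>" "Z \<in> sets lebesgue"
    using \<Omega>l by (auto simp: sets_restrict_space_iff)
  from \<open>Z \<in> sets lebesgue\<close>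
  obtain S N N' where SN: "Z = S \<union> N" "N \<subseteq> N'" "N' \<in> null_sets lborel" "S \<in> sets lborel"
    by (rule sets_completionE)
  have S: "S \<in> sets (restrict_space borel \<Omega>)"
    using SN \<open>Z \<subseteq> \<Omega>\<close> \<Omega>b by (auto simp: sets_restrict_space_iff)
  have S': "S \<in> sets (lebesgue_on \<Omega>)"
    using SN \<open>Z \<subseteq> \<Omega>\<close> \<Omega>l by (auto simp: sets_restrict_space_iff)
  have "N' \<in> null_sets lebesgue"
    using SN(3) by (rule null_sets_completionI)
  then have "AE x in lebesgue. x \<notin> N'"
    by (rule AE_not_in)
  then have "AE x in lebesgue_on \<Omega>. x \<notin> N'"
    using \<Omega>l by (auto simp: AE_restrict_space_iff elim: eventually_mono)
  then have "(\<integral>x. indicator Z x *\<^sub>R f x \<partial>lebesgue_on \<Omega>) = (\<integral>x. indicator S x *\<^sub>R f x \<partial>lebesgue_on \<Omega>)"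
    using f Z(1) S' by (intro integral_cong_AE borel_measurable_scaleR borel_measurable_indicator)
      (auto elim!: eventually_mono simp: indicator_def SN(1) intro: subsetD[OF SN(2)])
  with Z(2) S show ?thesis
    by auto
qed

section \<open>Convex closures and Slater multipliers\<close>

text \<open>Points of the closure are limits of points of \<open>S\<close>, and a convex combination
  depends continuously on its endpoints. The segments need only lie in the closure, which is all
  that approximate splicing can give.\<close>

lemma convex_closure_if_segments_in_closure:
  fixes S :: "'a::real_normed_vector set"
  assumes "\<And>a b \<theta>. a \<in> S \<Longrightarrow> b \<in> S \<Longrightarrow> 0 \<le> \<theta> \<Longrightarrow> \<theta> \<le> 1 \<Longrightarrow> a + \<theta> *\<^sub>R (b - a) \<in> closure S"
  shows "convex (closure S)"
proof (rule convexI)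
  fix x y and s t :: real
  assume xy: "x \<in> closure S" "y \<in> closure S" and st: "0 \<le> s" "0 \<le> t" "s + t = 1"
  obtain a b where ab: "\<And>n. a n \<in> S" "a \<longlonglongrightarrow> x" "\<And>n. b n \<in> S" "b \<longlonglongrightarrow> y"
    using xy by (auto simp: closure_sequential)
  have "(\<lambda>n. a n + t *\<^sub>R (b n - a n)) \<longlonglongrightarrow> x + t *\<^sub>R (y - x)"
    using ab by (intro tendsto_intros)
  moreover have "a n + t *\<^sub>R (b n - a n) \<in> closure S" for n
    using ab st by (intro assms) auto
  ultimately have "x + t *\<^sub>R (y - x) \<in> closure S"
    by (rule closed_sequentially[OF closed_closure, rotated])
  moreover have "x + t *\<^sub>R (y - x) = (1 - t) *\<^sub>R x + t *\<^sub>R y"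
    by (simp add: algebra_simps)
  moreover have "1 - t = s"
    using st by simp
  ultimately show "s *\<^sub>R x + t *\<^sub>R y \<in> closure S"
    by simp
qed

text \<open>Extracts the signs of multipliers: a separating functional stays nonnegative along every
  ray in the separated set.\<close>

lemma slope_nonneg_if_affine_nonneg:
  fixes a c :: real
  assumes "\<And>s. s \<ge> 0 \<Longrightarrow> 0 \<le> c + s * a"
  shows "0 \<le> a"
proof (rule ccontr)
  assume "\<not> 0 \<le> a"
  then have "(\<bar>c\<bar> + 1) / (- a) * a = - (\<bar>c\<bar> + 1)" "0 \<le> (\<bar>c\<bar> + 1) / (- a)"
    by (simp_all add: divide_nonneg_neg)
  then show False
    using assms[of "(\<bar>c\<bar> + 1) / (- a)"] by linarith
qed

text \<open>The constraints are relaxed strictly in \<open>S\<close>, so that points of \<open>K\<close> with \<open>g i v = 0\<close> for some \<open>i\<close>, about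
  which \<open>p\<close> says nothing, do not matter.\<close>

lemma slater_multipliers:
  fixes K :: "(real \<times> 'v::euclidean_space) set" and g :: "'m::finite \<Rightarrow> 'v \<Rightarrow> real"
  assumes K: "convex K" and g: "\<And>i. convex_on UNIV (g i)"
    and p: "\<And>t v. (t, v) \<in> K \<Longrightarrow> (\<And>i. g i v < 0) \<Longrightarrow> p \<le> t"
    and slater: "(t0, v0) \<in> K" "\<And>i. g i v0 < 0"
  obtains \<mu> :: 'v and \<nu> :: "real^'m" where "\<And>i. 0 \<le> \<nu> $ i"
    "\<And>t v z. (t, v) \<in> K \<Longrightarrow> p \<le> t + \<mu> \<bullet> (v - z) + (\<Sum>i\<in>UNIV. \<nu> $ i * g i z)"
proof -
  \<comment> \<open>\<open>u\<close> perturbs the inequalities and \<open>w\<close> the equation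
    \<open>z = v\<close>. Keeping \<open>z\<close> apart from \<open>v\<close> makes it the free
    variable of the Lagrangian. The origin in \<open>S\<close> would be a strictly feasible point of
    \<open>K\<close> with value below \<open>p\<close>.\<close>
  define S :: "(real \<times> (real^'m) \<times> 'v) set" where
    "S = {(r, u, w). \<exists>t v z. (t, v) \<in> K \<and> t - p < r \<and> (\<forall>i. g i z < u $ i) \<and> w = v - z}"
  have S_I: "(r, u, v - z) \<in> S" if "(t, v) \<in> K" "t - p < r" "\<And>i. g i z < u $ i" for t v z r u
    using that unfolding S_def by blast
  have "convex S"
  proof (rule convexI)
    fix x y and s s' :: real
    assume "x \<in> S" "y \<in> S" and s: "0 \<le> s" "0 \<le> s'" "s + s' = 1"
    then obtain r u w t v z r' u' w' t' v' z' where
      x: "x = (r, u, w)" "(t, v) \<in> K" "t - p < r" "\<And>i. g i z < u $ i" "w = v - z" and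
      y: "y = (r', u', w')" "(t', v') \<in> K" "t' - p < r'" "\<And>i. g i z' < u' $ i" "w' = v' - z'"
      unfolding S_def by blast
    \<comment> \<open>One weight may vanish, but not both, so strictness survives.\<close>
    have strict: "s * a + s' * a' < s * c + s' * c'" if "a < c" "a' < c'" for a a' c c' :: real
    proof (cases "s = 0")
      case False
      then show ?thesis
        using that s by (intro add_less_le_mono mult_strict_left_mono mult_left_mono) auto
    qed (use that s in simp)
    have "s *\<^sub>R (t, v) + s' *\<^sub>R (t', v') \<in> K"
      using K x(2) y(2) s by (rule convexD)
    then have "(s * t + s' * t', s *\<^sub>R v + s' *\<^sub>R v') \<in> K"
      by simp
    moreover have "s * t + s' * t' - p < s * r + s' * r'"
    proof -
      have "s * (t - p) + s' * (t' - p) = s * t + s' * t' - (s + s') * p"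
        by (simp add: algebra_simps)
      then show ?thesis
        using strict[OF x(3) y(3)] s by simp
    qed
    moreover have "g i (s *\<^sub>R z + s' *\<^sub>R z') < (s *\<^sub>R u + s' *\<^sub>R u') $ i" for i
    proof -
      have "g i (s *\<^sub>R z + s' *\<^sub>R z') \<le> s * g i z + s' * g i z'"
        using g[of i] s by (auto simp: convex_on_def)
      also have "\<dots> < s * u $ i + s' * u' $ i"
        using x(4) y(4) by (rule strict)
      finally show ?thesis by simp
    qed
    ultimately have "(s * r + s' * r', s *\<^sub>R u + s' *\<^sub>R u',
      (s *\<^sub>R v + s' *\<^sub>R v') - (s *\<^sub>R z + s' *\<^sub>R z')) \<in> S"
      by (rule S_I)
    also have "(s *\<^sub>R v + s' *\<^sub>R v') - (s *\<^sub>R z + s' *\<^sub>R z') = s *\<^sub>R w + s' *\<^sub>R w'"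
      by (simp only: x(5) y(5) scaleR_diff_right add_diff_add)
    finally show "s *\<^sub>R x + s' *\<^sub>R y \<in> S"
      by (simp add: x(1) y(1))
  qed
  moreover have "0 \<notin> S"
  proof
    assume "0 \<in> S"
    then obtain t v z where "(t, v) \<in> K" "t - p < 0" "\<forall>i. g i z < 0" "v = z"
      by (auto simp: S_def zero_prod_def)
    then show False
      using p[of t v] by auto
  qed
  ultimately have "\<exists>a. a \<noteq> 0 \<and> (\<forall>x\<in>S. 0 \<le> a \<bullet> x)"
    by (rule separating_hyperplane_set_0)
  then obtain a where a: "a \<noteq> 0" "\<And>x. x \<in> S \<Longrightarrow> 0 \<le> a \<bullet> x"
    by blast
  obtain \<alpha> \<nu> \<mu> where a_eq: "a = (\<alpha>, \<nu>, \<mu>)"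
    by (cases a) auto
  have sep: "0 \<le> \<alpha> * r + \<nu> \<bullet> u + \<mu> \<bullet> (v - z)"
    if "(t, v) \<in> K" "t - p < r" "\<And>i. g i z < u $ i" for t v z r u
    using a(2)[OF S_I[OF that]] by (simp add: a_eq inner_prod_def add.assoc)
  have \<alpha>: "0 \<le> \<alpha>"
  proof (rule slope_nonneg_if_affine_nonneg)
    fix s :: real assume "s \<ge> 0"
    then show "0 \<le> (\<alpha> * (t0 - p + 1) + \<nu> \<bullet> 0) + s * \<alpha>"
      using sep[OF slater(1), of "t0 - p + 1 + s" v0 0] slater(2) by (simp add: algebra_simps)
  qed
  have \<nu>: "0 \<le> \<nu> $ i" for i
  proof (rule slope_nonneg_if_affine_nonneg)
    fix s :: real assume "s \<ge> 0"
    \<comment> \<open>Since \<open>v0\<close> is strictly feasible, the whole ray of relaxations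
      along the \<open>i\<close>-th axis is available.\<close>
    then have "g j v0 < (s *\<^sub>R axis i 1) $ j" for j
      using slater(2)[of j] by (auto simp: axis_def intro: less_le_trans)
    then show "0 \<le> \<alpha> * (t0 - p + 1) + s * \<nu> $ i"
      using sep[OF slater(1), of "t0 - p + 1" v0 "s *\<^sub>R axis i 1"] by (simp add: inner_axis)
  qed
  have "\<alpha> \<noteq> 0"
  proof
    assume "\<alpha> = 0"
    \<comment> \<open>Halving keeps the relaxation strictly above \<open>g i v0\<close> and still
      negative. With \<open>\<alpha> = 0\<close> this gives a nonnegative sum of nonpositive terms,
      so all of them vanish and \<open>\<nu> = 0\<close>.\<close>
    have "0 \<le> (\<Sum>i\<in>UNIV. \<nu> $ i * (g i v0 / 2))"
      using sep[OF slater(1), of "t0 - p + 1" v0 "\<chi> i. g i v0 / 2"] slater(2) \<open>\<alpha> = 0\<close>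
      by (simp add: inner_vec_def)
    moreover have nonpos: "\<nu> $ i * (g i v0 / 2) \<le> 0" for i
      using \<nu>[of i] slater(2)[of i] by (simp add: mult_nonneg_nonpos)
    ultimately have "(\<Sum>i\<in>UNIV. - (\<nu> $ i * (g i v0 / 2))) = 0"
      using sum_nonpos[of UNIV "\<lambda>i. \<nu> $ i * (g i v0 / 2)"] by (simp add: sum_negf)
    then have "\<nu> $ i * (g i v0 / 2) = 0" for i
      using nonpos by (subst (asm) sum_nonneg_eq_0_iff) auto
    then have "\<nu> = 0"
      using slater(2) by (simp add: vec_eq_iff less_imp_neq)
    \<comment> \<open>Since \<open>z\<close> is unrestricted, it may be chosen so that
      \<open>w\<close> is the negative of \<open>\<mu>\<close>; the remaining term is then minus the
      square of the norm of \<open>\<mu>\<close>.\<close>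
    have "0 \<le> \<mu> \<bullet> (v0 - (v0 + \<mu>))"
      using sep[OF slater(1), of "t0 - p + 1" "v0 + \<mu>" "\<chi> i. g i (v0 + \<mu>) + 1"] \<open>\<alpha> = 0\<close> \<open>\<nu> = 0\<close>
      by simp
    then have "\<mu> = 0"
      using inner_gt_zero_iff[of \<mu>] by fastforce
    with \<open>\<alpha> = 0\<close> \<open>\<nu> = 0\<close> a show False
      by (simp add: a_eq zero_prod_def)
  qed
  with \<alpha> have pos: "\<alpha> > 0"
    by simp
  show thesis
  proof (rule that[of "\<nu> /\<^sub>R \<alpha>" "\<mu> /\<^sub>R \<alpha>"])
    fix t v z assume tv: "(t, v) \<in> K"
    define G where "G = (\<Sum>i\<in>UNIV. \<nu> $ i * g i z)"
    \<comment> \<open>Raising \<open>r\<close> and every component of \<open>u\<close> by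
      \<open>e / C\<close> meets the strict inequalities in \<open>S\<close> and costs exactly
      \<open>e\<close>.\<close>
    define C where "C = \<alpha> + (\<Sum>i\<in>UNIV. \<nu> $ i)"
    have C: "C > 0"
      using pos \<nu> unfolding C_def by (intro add_pos_nonneg sum_nonneg) auto
    have "0 \<le> \<alpha> * (t - p) + G + \<mu> \<bullet> (v - z)"
    proof (rule field_le_epsilon)
      fix e :: real assume "e > 0"
      then have "e / C > 0"
        using C by simp
      then have "0 \<le> \<alpha> * (t - p + e / C) + \<nu> \<bullet> (\<chi> i. g i z + e / C) + \<mu> \<bullet> (v - z)"
        by (intro sep[OF tv]) auto
      also have "\<nu> \<bullet> (\<chi> i. g i z + e / C) = G + (C - \<alpha>) * (e / C)"
        by (simp add: inner_vec_def G_def C_def algebra_simps sum.distrib flip: sum_distrib_left sum_divide_distrib)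
      also have "\<alpha> * (t - p + e / C) + (G + (C - \<alpha>) * (e / C)) + \<mu> \<bullet> (v - z)
        = \<alpha> * (t - p) + G + \<mu> \<bullet> (v - z) + e"
        using C by (simp add: field_simps)
      finally show "0 \<le> \<alpha> * (t - p) + G + \<mu> \<bullet> (v - z) + e" .
    qed
    then have "0 \<le> (\<alpha> * (t - p) + G + \<mu> \<bullet> (v - z)) / \<alpha>"
      using pos by simp
    also have "\<dots> = t - p + G / \<alpha> + \<mu> \<bullet> (v - z) / \<alpha>"
      using pos by (simp add: add_divide_distrib)
    finally show "p \<le> t + (\<mu> /\<^sub>R \<alpha>) \<bullet> (v - z) + (\<Sum>i\<in>UNIV. (\<nu> /\<^sub>R \<alpha>) $ i * g i z)"
      by (simp add: G_def divide_inverse sum_distrib_left mult_ac)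
  qed (use \<nu> pos in auto)
qed

section \<open>Attainable pairs of objective and integral\<close>

text \<open>Turns the real inner product used for separation into the pairing with complex
  multipliers in the Lagrangian.\<close>

lemma Re_herm_prod: "Re (herm_prod \<mu> v) = \<mu> \<bullet> v"
  by (simp add: herm_prod_def inner_vec_def inner_complex_def)

definition sfp_point ::
  "(real^'n) set \<Rightarrow> real \<Rightarrow> (complex \<Rightarrow> real^'n \<Rightarrow> real) \<Rightarrow> (complex \<Rightarrow> real^'n \<Rightarrow> complex^'p) \<Rightarrow>
   (real^'n \<Rightarrow> complex) \<Rightarrow> real \<times> (complex^'p)" where
  "sfp_point \<Omega> lam F0 F X = (sfp_objective \<Omega> lam F0 X, \<integral>\<beta>. F (X \<beta>) \<beta> \<partial>lebesgue_on \<Omega>)"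

text \<open>Writing the L0 norm as the integral of an indicator makes the nonconvex penalty local in
  \<open>\<beta>\<close>, so that it splices like the other integrands.\<close>

definition sfp_density ::
  "real \<Rightarrow> (complex \<Rightarrow> real^'n \<Rightarrow> real) \<Rightarrow> (complex \<Rightarrow> real^'n \<Rightarrow> complex^'p) \<Rightarrow>
   (real^'n \<Rightarrow> complex) \<Rightarrow> real^'n \<Rightarrow> real \<times> (complex^'p)" where
  "sfp_density lam F0 F X \<beta> = (F0 (X \<beta>) \<beta> + lam * indicator {\<beta>. X \<beta> \<noteq> 0} \<beta>, F (X \<beta>) \<beta>)"

lemma has_bochner_integral_Pair:
  fixes f :: "'a \<Rightarrow> 'b::{real_normed_vector, second_countable_topology}"
    and g :: "'a \<Rightarrow> 'c::{real_normed_vector, second_countable_topology}"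
  assumes "has_bochner_integral M f a" "has_bochner_integral M g b"
  shows "has_bochner_integral M (\<lambda>x. (f x, g x)) (a, b)"
proof -
  have "has_bochner_integral M (\<lambda>x. (f x, 0) + (0, g x)) ((a, 0) + (0, b))"
    using assms
    by (intro has_bochner_integral_add has_bochner_integral_bounded_linear[where T = "\<lambda>x. (x, 0)"]
        has_bochner_integral_bounded_linear[where T = "\<lambda>x. (0, x)"]
        bounded_linear_Pair bounded_linear_ident bounded_linear_zero)
  then show ?thesis by simp
qed

lemma has_bochner_integral_sfp_density:
  fixes \<Omega> :: "(real^'n) set"
  assumes \<Omega>: "compact \<Omega>" and X: "X \<in> admissible \<Omega> \<X> \<P> F0 F" "X \<in> borel_measurable (lebesgue_on \<Omega>)"
  shows "has_bochner_integral (lebesgue_on \<Omega>) (sfp_density lam F0 F X) (sfp_point \<Omega> lam F0 F X)"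
proof -
  have \<Omega>l: "\<Omega> \<in> lmeasurable" "\<Omega> \<in> sets lebesgue"
    using \<Omega> lmeasurable_compact fmeasurableD by blast+
  interpret finite_measure "lebesgue_on \<Omega>"
    using \<Omega>l by (intro finite_measure_lebesgue_on)
  let ?A = "{\<beta>\<in>\<Omega>. X \<beta> \<noteq> 0}"
  have "{\<beta> \<in> space (lebesgue_on \<Omega>). X \<beta> \<noteq> 0} \<in> sets (lebesgue_on \<Omega>)"
    using X(2) by measurable
  then have A: "?A \<in> sets (lebesgue_on \<Omega>)"
    by simp
  have "L0_norm \<Omega> X = measure (lebesgue_on \<Omega>) ?A"
    using \<Omega>l by (auto simp: L0_norm_def measure_restrict_space)
  then have "has_bochner_integral (lebesgue_on \<Omega>) (indicator ?A) (L0_norm \<Omega> X)"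
    using has_bochner_integral_real_indicator[OF A] by (simp add: less_top[symmetric])
  also have "has_bochner_integral (lebesgue_on \<Omega>) (indicator ?A) (L0_norm \<Omega> X) \<longleftrightarrow>
    has_bochner_integral (lebesgue_on \<Omega>) (indicat_real {\<beta>. X \<beta> \<noteq> 0}) (L0_norm \<Omega> X)"
    by (intro has_bochner_integral_cong) (auto simp: indicator_def)
  finally have "has_bochner_integral (lebesgue_on \<Omega>) (indicat_real {\<beta>. X \<beta> \<noteq> 0}) (L0_norm \<Omega> X)" .
  then show ?thesis
    using X(1) unfolding sfp_density_def sfp_point_def sfp_objective_def
    by (intro has_bochner_integral_Pair has_bochner_integral_add has_bochner_integral_mult_right
        has_bochner_integral_integrable) (auto simp: admissible_def)
qed

text \<open>Let \<open>Y\<close> be \<open>X2\<close> on \<open>Z\<close> and \<open>X1\<close>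
  elsewhere. Its point exceeds that of \<open>X1\<close> by the integral over \<open>Z\<close> of
  the difference of the two densities, and \<open>Z\<close> can be chosen to make this nearly the
  proportion \<open>\<theta>\<close> of the full difference.\<close>

lemma convex_closure_sfp_points:
  fixes \<Omega> :: "(real^'n) set" and F :: "complex \<Rightarrow> real^'n \<Rightarrow> complex^'p"
  assumes \<Omega>: "compact \<Omega>" and meas: "\<And>X. X \<in> \<X> \<Longrightarrow> X \<in> borel_measurable (lebesgue_on \<Omega>)"
    and dec: "decomposable \<Omega> \<X>"
  shows "convex (closure (sfp_point \<Omega> lam F0 F ` admissible \<Omega> \<X> \<P> F0 F))"
    (is "convex (closure (?pt ` ?Adm))")
proof (rule convex_closure_if_segments_in_closure)
  fix a b and \<theta> :: real
  assume a: "a \<in> ?pt ` ?Adm" and b: "b \<in> ?pt ` ?Adm" and \<theta>: "0 \<le> \<theta>" "\<theta> \<le> 1"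
  from a obtain X1 where a_eq: "a = ?pt X1" and X1: "X1 \<in> ?Adm"
    by (rule imageE)
  from b obtain X2 where b_eq: "b = ?pt X2" and X2: "X2 \<in> ?Adm"
    by (rule imageE)
  let ?M = "lebesgue_on \<Omega>"
  let ?d = "sfp_density lam F0 F"
  have \<Omega>b: "\<Omega> \<in> sets borel"
    using \<Omega> by (simp add: borel_compact)
  have d: "has_bochner_integral ?M (?d X) (?pt X)" if "X \<in> ?Adm" for X
    using that meas by (intro has_bochner_integral_sfp_density \<Omega>) (auto simp: admissible_def)
  have diff: "has_bochner_integral ?M (\<lambda>\<beta>. ?d X2 \<beta> - ?d X1 \<beta>) (?pt X2 - ?pt X1)"
    using d X1 X2 by (intro has_bochner_integral_diff)
  show "a + \<theta> *\<^sub>R (b - a) \<in> closure (?pt ` ?Adm)"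
    unfolding closure_approachable a_eq b_eq
  proof (intro allI impI)
    fix e :: real assume "e > 0"
    have "integrable ?M (\<lambda>\<beta>. ?d X2 \<beta> - ?d X1 \<beta>)"
      using diff by (rule integrable.intros)
    from ex_borel_approx_lyapunov[OF \<Omega> this \<open>e > 0\<close> \<theta>]
    obtain Z where Z: "Z \<in> sets (restrict_space borel \<Omega>)"
      "norm ((\<integral>\<beta>. indicator Z \<beta> *\<^sub>R (?d X2 \<beta> - ?d X1 \<beta>) \<partial>?M) - \<theta> *\<^sub>R (?pt X2 - ?pt X1)) < e"
      unfolding has_bochner_integral_integral_eq[OF diff] by blast
    have X12: "X2 \<in> \<X>" "X1 \<in> \<X>"
      using X1 X2 by (auto simp: admissible_def)
    obtain Y where Y: "Y \<in> \<X>" "\<And>\<beta>. \<beta> \<in> Z \<Longrightarrow> Y \<beta> = X2 \<beta>" "\<And>\<beta>. \<beta> \<in> \<Omega> - Z \<Longrightarrow> Y \<beta> = X1 \<beta>"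
      using dec[unfolded decomposable_def, rule_format, OF X12 Z(1)] by blast
    have Zs: "Z \<in> sets ?M"
      using Z(1) \<Omega>b by (auto simp: sets_restrict_space_iff)
    \<comment> \<open>On \<open>\<Omega>\<close> the spliced integrand is that of \<open>X1\<close>
      plus the difference cut off to \<open>Z\<close>, so \<open>Y\<close> inherits finite
      integrals.\<close>
    have splice: "integrable ?M (\<lambda>\<beta>. H (Y \<beta>) \<beta>)"
      if "integrable ?M (\<lambda>\<beta>. H (X1 \<beta>) \<beta>)" "integrable ?M (\<lambda>\<beta>. H (X2 \<beta>) \<beta>)"
      for H :: "complex \<Rightarrow> real^'n \<Rightarrow> 'q::{banach, second_countable_topology}"
    proof -
      have "integrable ?M (\<lambda>\<beta>. H (X1 \<beta>) \<beta> + indicator Z \<beta> *\<^sub>R (H (X2 \<beta>) \<beta> - H (X1 \<beta>) \<beta>))"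
        using that Zs by (intro Bochner_Integration.integrable_add integrable_mult_indicator) auto
      also have "?this \<longleftrightarrow> ?thesis"
        using Y by (intro Bochner_Integration.integrable_cong) (auto simp: indicator_def)
      finally show ?thesis .
    qed
    have "AE \<beta> in ?M. Y \<beta> \<in> \<P>"
    proof -
      have "AE \<beta> in ?M. X1 \<beta> \<in> \<P>" "AE \<beta> in ?M. X2 \<beta> \<in> \<P>" "AE \<beta> in ?M. \<beta> \<in> \<Omega>"
        using X1 X2 AE_space[of ?M] by (auto simp: admissible_def)
      then show ?thesis
        by eventually_elim (use Y in \<open>metis DiffI\<close>)
    qed
    then have YA: "Y \<in> ?Adm"
      using Y(1) X1 X2 splice[of F0] splice[of F] by (auto simp: admissible_def)
    have "(\<integral>\<beta>. indicator Z \<beta> *\<^sub>R (?d X2 \<beta> - ?d X1 \<beta>) \<partial>?M) = (\<integral>\<beta>. ?d Y \<beta> - ?d X1 \<beta> \<partial>?M)"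
      using Y by (intro Bochner_Integration.integral_cong) (auto simp: indicator_def sfp_density_def)
    also have "\<dots> = ?pt Y - ?pt X1"
      using d[OF YA] d[OF X1] by (intro has_bochner_integral_integral_eq has_bochner_integral_diff)
    finally have "dist (?pt Y) (?pt X1 + \<theta> *\<^sub>R (?pt X2 - ?pt X1)) < e"
      using Z(2) by (simp add: dist_norm diff_diff_eq)
    with YA show "\<exists>y\<in>?pt ` ?Adm. dist y (?pt X1 + \<theta> *\<^sub>R (?pt X2 - ?pt X1)) < e"
      by blast
  qed
qed

section \<open>Strong duality\<close>

theorem theorem1:
  fixes \<Omega> :: "(real^'n) set"
    and \<X> :: "(real^'n \<Rightarrow> complex) set"
    and \<P> :: "complex set"
    and lam :: real
    and F0 :: "complex \<Rightarrow> real^'n \<Rightarrow> real"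
    and F :: "complex \<Rightarrow> real^'n \<Rightarrow> complex^'p"
    and g :: "'m::finite \<Rightarrow> complex^'p \<Rightarrow> real"
  assumes "compact \<Omega>"
    and "lam > 0"
    and "\<And>i. convex_on UNIV (g i)"
    and "\<And>X. X \<in> \<X> \<Longrightarrow> X \<in> borel_measurable (lebesgue_on \<Omega>)"
    and "decomposable \<Omega> \<X>"
    and "\<And>X. X \<in> admissible \<Omega> \<X> \<P> F0 F \<Longrightarrow>
           nonatomic (restrict_space borel \<Omega>) (\<lambda>Z. \<integral>\<beta>. F0 (X \<beta>) \<beta> \<partial>lebesgue_on Z)"
    and "\<And>X. X \<in> admissible \<Omega> \<X> \<P> F0 F \<Longrightarrow>
           nonatomic (restrict_space borel \<Omega>) (\<lambda>Z. \<integral>\<beta>. F (X \<beta>) \<beta> \<partial>lebesgue_on Z)"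
    and "\<exists>(X', z')\<in>sfp_feasible \<Omega> \<X> \<P> F0 F g. \<forall>i. g i z' < 0"
  shows "sfp_primal_value \<Omega> \<X> \<P> lam F0 F g = sfp_dual_value \<Omega> \<X> \<P> lam F0 F g"
proof (rule antisym)
  let ?Adm = "admissible \<Omega> \<X> \<P> F0 F"
  let ?pt = "sfp_point \<Omega> lam F0 F"
  let ?P = "sfp_primal_value \<Omega> \<X> \<P> lam F0 F g"
  \<comment> \<open>A feasible \<open>z\<close> is determined by \<open>X\<close>, so the primal
    problem is a minimization over points of the form \<open>?pt X\<close>.\<close>
  have primal_le: "?P \<le> ereal (fst (?pt X))"
    if "X \<in> ?Adm" "\<And>i. g i (snd (?pt X)) \<le> 0" for X
    unfolding sfp_primal_value_def using that
    by (intro INF_lower2[of "(X, snd (?pt X))"]) (auto simp: sfp_feasible_def sfp_point_def)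
  obtain X0 where X0: "X0 \<in> ?Adm" "\<And>i. g i (snd (?pt X0)) < 0"
    using assms(8) by (auto simp: sfp_feasible_def sfp_point_def)
  show "?P \<le> sfp_dual_value \<Omega> \<X> \<P> lam F0 F g"
  proof (cases ?P)
    case PInf
    \<comment> \<open>The Slater point bounds the primal value by a finite number. The value minus
      infinity, left to the final \<open>simp\<close>, is trivial.\<close>
    then show ?thesis
      using primal_le[OF X0(1)] X0(2) by (auto simp: less_imp_le)
  next
    case (real p)
    let ?K = "closure (?pt ` ?Adm)"
    have conv: "convex ?K"
      using assms by (intro convex_closure_sfp_points)
    have p: "p \<le> t" if tv: "(t, v) \<in> ?K" and v: "\<And>i. g i v < 0" for t v
    proof (rule ccontr)
      assume "\<not> p \<le> t"
      \<comment> \<open>Finite convex functions on the whole space are continuous, so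
        \<open>U\<close> is open. A point of the closure in \<open>U\<close> would yield an attained
        point in \<open>U\<close>: a feasible function with objective below
        \<open>p\<close>.\<close>
      define U where "U = {x. fst x < p} \<inter> (\<Inter>i. {x. g i (snd x) < 0})"
      have cont: "continuous_on UNIV (g i)" for i
        using assms(3) by (intro convex_on_continuous) auto
      have "open U"
        unfolding U_def
        by (intro open_Int open_INT open_Collect_less continuous_intros ballI finite_UNIV
            continuous_on_compose2[OF cont]) auto
      moreover have "(t, v) \<in> U"
        using \<open>\<not> p \<le> t\<close> v by (auto simp: U_def)
      ultimately have "U \<inter> ?pt ` ?Adm \<noteq> {}"
        using tv open_Int_closure_eq_empty[of U "?pt ` ?Adm"] by blast
      then obtain X where "X \<in> ?Adm" "?pt X \<in> U"
        by blast
      then have X: "X \<in> ?Adm" "fst (?pt X) < p" "\<And>i. g i (snd (?pt X)) < 0"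
        by (simp_all add: U_def)
      then have "?P \<le> ereal (fst (?pt X))"
        by (intro primal_le) (auto simp: less_imp_le)
      with X(2) real show False
        by simp
    qed
    obtain \<mu> and \<nu> :: "real^'m" where \<nu>: "\<And>i. 0 \<le> \<nu> $ i"
      and L: "\<And>t v z. (t, v) \<in> ?K \<Longrightarrow> p \<le> t + \<mu> \<bullet> (v - z) + (\<Sum>i\<in>UNIV. \<nu> $ i * g i z)"
    proof (rule slater_multipliers[of ?K g p])
      show "(fst (?pt X0), snd (?pt X0)) \<in> ?K"
        using X0(1) closure_subset by fastforce
    qed (use conv assms(3) p X0(2) in auto)
    have "?P \<le> sfp_dual_function \<Omega> \<X> \<P> lam F0 F g \<mu> \<nu>"
      unfolding sfp_dual_function_def
    proof (intro INF_greatest, clarify)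
      fix X z assume "X \<in> ?Adm"
      then have "?pt X \<in> ?K"
        using closure_subset by fastforce
      then show "?P \<le> ereal (sfp_lagrangian \<Omega> lam F0 F g X z \<mu> \<nu>)"
        using L[of "fst (?pt X)" "snd (?pt X)" z] real
        by (simp add: sfp_lagrangian_def sfp_point_def sfp_objective_def Re_herm_prod)
    qed
    also have "\<dots> \<le> sfp_dual_value \<Omega> \<X> \<P> lam F0 F g"
      unfolding sfp_dual_value_def using \<nu> by (intro SUP_upper2[of "(\<mu>, \<nu>)"]) auto
    finally show ?thesis .
  qed simp
  \<comment> \<open>Weak duality: at a feasible pair the equality term of the Lagrangian vanishes
    and the inequality terms are nonpositive.\<close>
  show "sfp_dual_value \<Omega> \<X> \<P> lam F0 F g \<le> ?P"
    unfolding sfp_dual_value_def sfp_primal_value_def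
  proof (intro SUP_least INF_greatest, clarify)
    fix \<mu> and \<nu> :: "real^'m" and X z
    assume \<nu>: "\<forall>i. 0 \<le> \<nu> $ i" and Xz: "(X, z) \<in> sfp_feasible \<Omega> \<X> \<P> F0 F g"
    then have "sfp_dual_function \<Omega> \<X> \<P> lam F0 F g \<mu> \<nu> \<le> ereal (sfp_lagrangian \<Omega> lam F0 F g X z \<mu> \<nu>)"
      unfolding sfp_dual_function_def by (intro INF_lower2[of "(X, z)"]) (auto simp: sfp_feasible_def)
    also have "(\<Sum>i\<in>UNIV. \<nu> $ i * g i z) \<le> 0"
      using \<nu> Xz by (intro sum_nonpos mult_nonneg_nonpos) (auto simp: sfp_feasible_def)
    then have "ereal (sfp_lagrangian \<Omega> lam F0 F g X z \<mu> \<nu>) \<le> ereal (sfp_objective \<Omega> lam F0 X)"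
      using Xz by (auto simp: sfp_feasible_def sfp_lagrangian_def sfp_objective_def herm_prod_def)
    finally show "sfp_dual_function \<Omega> \<X> \<P> lam F0 F g \<mu> \<nu> \<le> ereal (sfp_objective \<Omega> lam F0 X)" .
  qed
qed

end
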